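(* Let $M>0$ and, for positive numbers $D,d$, let $V(D,d)=-\frac{M}{\sigma(D,d)}$, where $\sigma(D,d)$ is the arithmetic-geometric mean of $D$ and $d$. Then for $D\ge d>0$, $$\frac{\partial}{\partial D}V(D,d)=\frac{\chi-1}{D}\,V(D,d),\qquad \frac{\partial}{\partial d}V(D,d)=-\frac{\chi}{d}\,V(D,d),$$ where $$\chi=\sum_{n=1}^{+\infty}\frac{1}{2^n}\,\frac{d_{n-1}}{D_n}\prod_{j=1}^{n-1}\left(1-\frac{d_{j-1}}{D_j}\right),$$ with $D_0=D$, $d_0=d$, $D_n=\frac{D_{n-1}+d_{n-1}}{2}$ and $d_n=\sqrt{D_{n-1}d_{n-1}}$ for $n\ge1$.
   Context: The arithmetic-geometric mean $\sigma(D,d)$ of two positive numbers is the common limit of the sequences $D_n$ (successive arithmetic means) and $d_n$ (successive geometric means). $V$ is the potential, at a point $P$, of a homogeneous circle of mass $M$, expressed in terms of the maximum distance $D$ and minimum distance $d$ from $P$ to the circle. The empty product (for $n=1$) equals $1$. *)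

theory Defs
  imports "HOL-Analysis.Analysis"
begin

fun agm_A :: "real \<Rightarrow> real \<Rightarrow> nat \<Rightarrow> real"
  and agm_G :: "real \<Rightarrow> real \<Rightarrow> nat \<Rightarrow> real" where
  "agm_A D d 0 = D"
| "agm_A D d (Suc n) = (agm_A D d n + agm_G D d n) / 2"
| "agm_G D d 0 = d"
| "agm_G D d (Suc n) = sqrt (agm_A D d n * agm_G D d n)"

definition agm :: "real \<Rightarrow> real \<Rightarrow> real" where
  "agm D d = (THE s. agm_A D d \<longlonglongrightarrow> s \<and> agm_G D d \<longlonglongrightarrow> s)"

lemma agm_AG_pos:
  assumes "D > 0" "d > 0"
  shows "agm_A D d n > 0 \<and> agm_G D d n > 0"
  using assms by (induction n) auto

lemma agm_G_le_A_Suc: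
  assumes "D > 0" "d > 0"
  shows "agm_G D d (Suc n) \<le> agm_A D d (Suc n)"
  using arith_geo_mean_sqrt[of "agm_A D d n" "agm_G D d n"] agm_AG_pos[OF assms, of n]
  by simp

text \<open>For positive arguments both sequences do converge to \<open>agm D d\<close>.\<close>

lemma agm_limits:
  assumes "D > 0" "d > 0"
  shows "agm_A D d \<longlonglongrightarrow> agm D d" "agm_G D d \<longlonglongrightarrow> agm D d"
proof -
  note agm_A.simps [simp del] and agm_G.simps [simp del]
  let ?A = "\<lambda>n. agm_A D d (Suc n)" and ?G = "\<lambda>n. agm_G D d (Suc n)"
  have pos: "agm_A D d n > 0" "agm_G D d n > 0" for n
    using agm_AG_pos[OF assms] by auto
  have le: "?G n \<le> ?A n" for n
    using agm_G_le_A_Suc[OF assms] .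
  have dec: "decseq ?A"
  proof (rule decseq_SucI)
    fix n
    have "(?A n + ?G n) / 2 \<le> ?A n"
      using le[of n] by simp
    thus "?A (Suc n) \<le> ?A n"
      by (subst agm_A.simps(2))
  qed
  have inc: "incseq ?G"
  proof (rule incseq_SucI)
    fix n
    have "?G n = sqrt (?G n * ?G n)"
      using pos(2)[of "Suc n"] by simp
    also have "\<dots> \<le> sqrt (?A n * ?G n)"
      using le[of n] pos(2)[of "Suc n"] by (intro real_sqrt_le_mono mult_right_mono) auto
    also have "\<dots> = ?G (Suc n)"
      by (subst (2) agm_G.simps(2)) simp
    finally show "?G n \<le> ?G (Suc n)" .
  qed
  obtain a where a: "?A \<longlonglongrightarrow> a"
    using decseq_convergent[OF dec, of 0] pos(1) by (metis less_imp_le)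
  have "?G n \<le> ?A 0" for n
    using le[of n] decseqD[OF dec, of 0 n] by linarith
  then obtain b where b: "?G \<longlonglongrightarrow> b"
    using incseq_convergent[OF inc] by metis
  have "(\<lambda>n. (?A n + ?G n) / 2) \<longlonglongrightarrow> (a + b) / 2"
    by (intro tendsto_intros a b) simp
  moreover have "(\<lambda>n. (?A n + ?G n) / 2) = (\<lambda>n. ?A (Suc n))"
    by (rule ext) (rule agm_A.simps(2)[symmetric])
  ultimately have "(\<lambda>n. ?A (Suc n)) \<longlonglongrightarrow> (a + b) / 2"
    by simp
  with LIMSEQ_Suc[OF a] have "a = (a + b) / 2"
    using LIMSEQ_unique by blast
  hence "a = b" by simp
  hence "agm_A D d \<longlonglongrightarrow> a" "agm_G D d \<longlonglongrightarrow> a"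
    using a b by (auto intro: LIMSEQ_imp_Suc)
  hence "\<exists>!s. agm_A D d \<longlonglongrightarrow> s \<and> agm_G D d \<longlonglongrightarrow> s"
    using LIMSEQ_unique by blast
  from theI'[OF this] show "agm_A D d \<longlonglongrightarrow> agm D d" "agm_G D d \<longlonglongrightarrow> agm D d"
    by (simp_all add: agm_def)
qed

definition circle_potential :: "real \<Rightarrow> real \<Rightarrow> real \<Rightarrow> real" where
  "circle_potential M D d = - (M / agm D d)"

text \<open>The \<open>n\<close>-th summand of \<open>\<chi>\<close>, meant for \<open>n \<ge> 1\<close>.\<close>

definition chi_term :: "real \<Rightarrow> real \<Rightarrow> nat \<Rightarrow> real" where
  "chi_term D d n = 1 / 2 ^ n * (agm_G D d (n - 1) / agm_A D d n) *
     (\<Prod>j = 1..n - 1. 1 - agm_G D d (j - 1) / agm_A D d j)"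

definition chi :: "real \<Rightarrow> real \<Rightarrow> real" where
  "chi D d = (\<Sum>n. chi_term D d (Suc n))"

end

theory Submission
  imports Defs
begin

text \<open>
  Regard all quantities as functions of the logarithms of the starting values. One step of the
  iteration is smooth in these coordinates: the logarithmic derivative of the geometric mean is the
  plain average of the two previous ones, and the logarithmic derivative of the arithmetic mean is
  an average weighted by the two numbers themselves. Hence, if \<open>D\<close> and \<open>d\<close> move with logarithmic
  velocities \<open>p\<close> and \<open>q\<close>, the difference of the logarithmic velocities of \<open>G\<^sub>n\<close> and \<open>A\<^sub>n\<close> gets
  multiplied by \<open>(1 - G\<^sub>n / A\<^sub>n\<^sub>+\<^sub>1) / 2\<close> in each step, and the velocity of \<open>A\<^sub>n\<close> changes by
  \<open>G\<^sub>n / (2 A\<^sub>n\<^sub>+\<^sub>1)\<close> times that difference. Unrolling the recursion shows that \<open>ln A\<^sub>n\<close> has velocity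
  \<open>p + (q - p) S\<^sub>n\<close>, where \<open>S\<^sub>n\<close> is exactly the \<open>n\<close>-th partial sum of \<open>\<chi>\<close>
  (lemma \<open>DERIV_agm_iterates\<close>).

  The terms of \<open>\<chi>\<close> are bounded by \<open>2 / 2\<^sup>n\<close> for all positive starting values, since
  \<open>0 < G\<^sub>n\<^sub>-\<^sub>1 / A\<^sub>n < 2\<close>. So the velocities converge uniformly along a whole path
  \<open>(D e\<^sup>p\<^sup>t, d e\<^sup>q\<^sup>t)\<close>, and the limit may be differentiated term by term: \<open>ln (agm D d)\<close> has
  velocity \<open>p + (q - p) \<chi>\<close> (lemma \<open>DERIV_ln_agm_exp_path\<close>). The choices \<open>(p, q) = (1, 0)\<close> and
  \<open>(0, 1)\<close> give the logarithmic partial derivatives \<open>1 - \<chi>\<close> and \<open>\<chi>\<close> of the mean, and the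
  potential, being proportional to its reciprocal, has the opposite ones.
\<close>

section \<open>The series \<open>\<chi>\<close>\<close>

text \<open>The factor by which an initial difference of logarithmic velocities of the two iterates
  has shrunk after \<open>n\<close> steps.\<close>

definition agm_gap :: "real \<Rightarrow> real \<Rightarrow> nat \<Rightarrow> real" where
  "agm_gap D d n = (\<Prod>j = 1..n. 1 - agm_G D d (j - 1) / agm_A D d j) / 2 ^ n"

lemma agm_gap_0 [simp]: "agm_gap D d 0 = 1"
  by (simp add: agm_gap_def)

lemma agm_gap_Suc:
  "agm_gap D d (Suc n) = agm_gap D d n * (1 - agm_G D d n / agm_A D d (Suc n)) / 2"
  by (simp add: agm_gap_def del: agm_A.simps agm_G.simps)

lemma chi_term_Suc_eq:
  "chi_term D d (Suc n) = agm_G D d n / (2 * agm_A D d (Suc n)) * agm_gap D d n"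
  by (simp add: chi_term_def agm_gap_def del: agm_A.simps agm_G.simps)

lemma agm_G_over_A_Suc_bounds:
  assumes "D > 0" "d > 0"
  shows "0 < agm_G D d n / agm_A D d (Suc n)" "agm_G D d n / agm_A D d (Suc n) < 2"
  using agm_AG_pos[OF assms, of n] by (auto simp: field_simps)

lemma abs_agm_gap_le:
  assumes "D > 0" "d > 0"
  shows "\<bar>agm_gap D d n\<bar> \<le> (1 / 2) ^ n"
proof (induction n)
  case (Suc n)
  have "\<bar>1 - agm_G D d n / agm_A D d (Suc n)\<bar> \<le> 1"
    using agm_G_over_A_Suc_bounds[OF assms, of n] by linarith
  with Suc have "\<bar>agm_gap D d n\<bar> * \<bar>1 - agm_G D d n / agm_A D d (Suc n)\<bar> \<le> (1 / 2) ^ n * 1"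
    by (intro mult_mono) auto
  then show ?case
    by (simp add: agm_gap_Suc abs_mult del: agm_A.simps agm_G.simps)
qed simp

text \<open>The bound does not depend on \<open>D\<close> and \<open>d\<close>; this is what makes \<open>\<chi>\<close> converge uniformly on
  the whole quadrant, so that no restriction to compact sets is necessary.\<close>

lemma abs_chi_term_Suc_le:
  assumes "D > 0" "d > 0"
  shows "\<bar>chi_term D d (Suc n)\<bar> \<le> (1 / 2) ^ n"
proof -
  have "\<bar>agm_G D d n / (2 * agm_A D d (Suc n))\<bar> \<le> 1"
    using agm_AG_pos[OF assms, of n] by (simp add: field_simps)
  then have "\<bar>agm_G D d n / (2 * agm_A D d (Suc n))\<bar> * \<bar>agm_gap D d n\<bar> \<le> 1 * (1 / 2) ^ n"
    using abs_agm_gap_le[OF assms, of n] by (intro mult_mono) auto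
  then show ?thesis
    by (simp add: chi_term_Suc_eq abs_mult del: agm_A.simps agm_G.simps)
qed

lemma summable_chi_term:
  assumes "D > 0" "d > 0"
  shows "summable (\<lambda>n. chi_term D d (Suc n))"
  by (rule summable_comparison_test'[where g = "\<lambda>n. (1 / 2) ^ n" and N = 0])
     (use abs_chi_term_Suc_le[OF assms] in \<open>auto intro: summable_geometric\<close>)

section \<open>Logarithmic derivatives of the iterates and of their limit\<close>

text \<open>Both iterates have to be differentiated together, because each step mixes them; the
  invariant is that their logarithmic derivatives differ by \<open>q - p\<close> times the gap factor.\<close>

lemma DERIV_agm_iterates:
  fixes x y :: "real \<Rightarrow> real"
  assumes pos: "x t > 0" "y t > 0"
    and x: "(x has_real_derivative x t * p) (at t)"
    and y: "(y has_real_derivative y t * q) (at t)"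
  defines "S \<equiv> \<lambda>n. \<Sum>k<n. chi_term (x t) (y t) (Suc k)"
  shows "((\<lambda>s. agm_A (x s) (y s) n) has_real_derivative
           agm_A (x t) (y t) n * (p + (q - p) * S n)) (at t) \<and>
         ((\<lambda>s. agm_G (x s) (y s) n) has_real_derivative
           agm_G (x t) (y t) n * (p + (q - p) * (S n + agm_gap (x t) (y t) n))) (at t)"
proof (induction n)
  case 0
  show ?case
    using x y by (simp add: S_def)
next
  case (Suc n)
  let ?A = "agm_A (x t) (y t)" and ?G = "agm_G (x t) (y t)"
  define E where "E = agm_gap (x t) (y t) n"
  define a where "a = p + (q - p) * S n"
  define g where "g = a + (q - p) * E"
  have A: "((\<lambda>s. agm_A (x s) (y s) n) has_real_derivative ?A n * a) (at t)"
    and G: "((\<lambda>s. agm_G (x s) (y s) n) has_real_derivative ?G n * g) (at t)"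
    using Suc by (simp_all add: a_def g_def E_def algebra_simps)
  have AG: "?A n > 0" "?G n > 0"
    using agm_AG_pos[of "x t" "y t" n] pos by auto
  have S_Suc: "S (Suc n) = S n + ?G n / (?A n + ?G n) * E"
    using AG by (simp add: S_def chi_term_Suc_eq E_def field_simps)
  have gap_Suc: "S (Suc n) + agm_gap (x t) (y t) (Suc n) = S n + E / 2"
  proof -
    have "agm_gap (x t) (y t) (Suc n) = E * (1 - ?G n / ((?A n + ?G n) / 2)) / 2"
      by (simp add: agm_gap_Suc E_def)
    then show ?thesis
      using AG by (simp add: S_Suc field_simps)
  qed
  have "((\<lambda>s. agm_A (x s) (y s) (Suc n)) has_real_derivative (?A n * a + ?G n * g) / 2) (at t)"
    unfolding agm_A.simps by (intro DERIV_cdivide DERIV_add A G)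
  moreover have "(?A n * a + ?G n * g) / 2 = ?A (Suc n) * (p + (q - p) * S (Suc n))"
  proof -
    have "(?A n + ?G n) * (a + (q - p) * (?G n / (?A n + ?G n) * E)) = ?A n * a + ?G n * g"
      using AG by (simp add: g_def field_simps)
    moreover have "a + (q - p) * (?G n / (?A n + ?G n) * E) = p + (q - p) * S (Suc n)"
      unfolding S_Suc a_def by (simp only: distrib_left add.assoc)
    ultimately show ?thesis
      by simp
  qed
  ultimately have A': "((\<lambda>s. agm_A (x s) (y s) (Suc n)) has_real_derivative
      ?A (Suc n) * (p + (q - p) * S (Suc n))) (at t)"
    by simp
  have prod_pos: "?A n * ?G n > 0"
    using AG by simp
  have "((\<lambda>s. agm_G (x s) (y s) (Suc n)) has_real_derivative
      (?A n * a * ?G n + ?G n * g * ?A n) * (inverse (sqrt (?A n * ?G n)) / 2)) (at t)"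
    unfolding agm_G.simps
    using DERIV_chain2[OF DERIV_real_sqrt[OF prod_pos] DERIV_mult[OF A G]]
    by (simp add: mult.commute)
  moreover have "(?A n * a * ?G n + ?G n * g * ?A n) * (inverse (sqrt (?A n * ?G n)) / 2)
      = ?G (Suc n) * ((a + g) / 2)"
  proof -
    define r where "r = sqrt (?A n * ?G n)"
    have r: "r > 0" "r * r = ?A n * ?G n"
      using prod_pos by (simp_all add: r_def)
    have "?A n * a * ?G n + ?G n * g * ?A n = r * r * (a + g)"
      by (simp add: r algebra_simps)
    then show ?thesis
      using r(1) by (simp add: r_def[symmetric])
  qed
  moreover have "(a + g) / 2
      = p + (q - p) * (S (Suc n) + agm_gap (x t) (y t) (Suc n))"
    unfolding gap_Suc by (simp add: a_def g_def field_simps)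
  ultimately have "((\<lambda>s. agm_G (x s) (y s) (Suc n)) has_real_derivative
      ?G (Suc n) * (p + (q - p) * (S (Suc n) + agm_gap (x t) (y t) (Suc n)))) (at t)"
    by simp
  with A' show ?case
    by blast
qed

lemma agm_pos:
  assumes "D > 0" "d > 0"
  shows "agm D d > 0"
proof -
  have "min D d \<le> agm_A D d n \<and> min D d \<le> agm_G D d n" for n
  proof (induction n)
    case (Suc n)
    have "min D d = sqrt (min D d * min D d)"
      using assms by simp
    also have "\<dots> \<le> sqrt (agm_A D d n * agm_G D d n)"
      using Suc assms by (intro real_sqrt_le_mono mult_mono) auto
    finally show ?case
      using Suc by simp
  qed simp
  then have "min D d \<le> agm D d"
    using LIMSEQ_le_const[OF agm_limits(1)[OF assms]] by blast
  then show ?thesis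
    using assms by linarith
qed

text \<open>Along an exponential path the logarithmic velocities \<open>p\<close>, \<open>q\<close> are constant, and the path
  stays in the quadrant for all times, so the series of derivatives converges uniformly on the
  whole line. The telescoping sum turns the sequence \<open>ln A\<^sub>n\<close> into that series.\<close>

lemma DERIV_ln_agm_exp_path:
  assumes "D > 0" "d > 0"
  shows "((\<lambda>t. ln (agm (D * exp (p * t)) (d * exp (q * t)))) has_real_derivative
           p + (q - p) * chi D d) (at 0)"
proof -
  define x where "x t = D * exp (p * t)" for t
  define y where "y t = d * exp (q * t)" for t
  define l where "l n t = ln (agm_A (x t) (y t) n)" for n t
  define f where "f n t = l (Suc n) t - l n t" for n t
  have pos: "x t > 0" "y t > 0" for t
    using assms by (simp_all add: x_def y_def)
  have x': "(x has_real_derivative x t * p) (at t)" for t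
    unfolding x_def by (auto intro!: derivative_eq_intros)
  have y': "(y has_real_derivative y t * q) (at t)" for t
    unfolding y_def by (auto intro!: derivative_eq_intros)
  have l': "(l n has_real_derivative p + (q - p) * (\<Sum>k<n. chi_term (x t) (y t) (Suc k))) (at t)"
    for n t
  proof -
    have A: "agm_A (x t) (y t) n > 0"
      using agm_AG_pos[OF pos] by blast
    then show ?thesis
      using DERIV_chain2[OF DERIV_ln[OF A]
          conjunct1[OF DERIV_agm_iterates[OF pos x' y', of n]]]
      unfolding l_def by (simp add: mult.assoc[symmetric])
  qed
  have f': "(f n has_real_derivative (q - p) * chi_term (x t) (y t) (Suc n)) (at t)" for n t
    unfolding f_def using DERIV_diff[OF l'[of "Suc n" t] l'[of n t]]
    by (simp add: algebra_simps)
  have sums: "(\<lambda>n. f n t) sums (ln (agm (x t) (y t)) - l 0 t)" for t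
  proof -
    have "(\<lambda>n. l n t) \<longlonglongrightarrow> ln (agm (x t) (y t))"
      unfolding l_def using agm_pos[OF pos] agm_limits(1)[OF pos]
      by (intro tendsto_ln) (auto simp: less_imp_neq[symmetric])
    then show ?thesis
      unfolding f_def by (rule telescope_sums)
  qed
  have unif: "uniformly_convergent_on UNIV
      (\<lambda>n t. \<Sum>i<n. (q - p) * chi_term (x t) (y t) (Suc i))"
  proof (rule Weierstrass_m_test')
    show "norm ((q - p) * chi_term (x t) (y t) (Suc n)) \<le> \<bar>q - p\<bar> * (1 / 2) ^ n" for n t
      using abs_chi_term_Suc_le[OF pos] by (simp add: abs_mult mult_left_mono)
    show "summable (\<lambda>n. \<bar>q - p\<bar> * (1 / 2 :: real) ^ n)"
      by (intro summable_mult summable_geometric) simp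
  qed
  have "((\<lambda>t. \<Sum>n. f n t) has_real_derivative
      (\<Sum>n. (q - p) * chi_term (x 0) (y 0) (Suc n))) (at 0)"
    by (rule has_field_derivative_series'(2)[OF convex_UNIV _ unif, where f = f and ?x0.0 = 0])
       (use f' sums_summable[OF sums] in auto)
  moreover have "(\<lambda>t. \<Sum>n. f n t) = (\<lambda>t. ln (agm (x t) (y t)) - l 0 t)"
    using sums by (simp add: sums_iff)
  moreover have "(\<Sum>n. (q - p) * chi_term (x 0) (y 0) (Suc n)) = (q - p) * chi D d"
    using suminf_mult[OF summable_chi_term[OF assms]] by (simp add: x_def y_def chi_def)
  ultimately have "((\<lambda>t. ln (agm (x t) (y t)) - l 0 t) has_real_derivative
      (q - p) * chi D d) (at 0)"
    by simp
  from DERIV_add[OF l'[of 0 0] this] show ?thesis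
    by (simp add: x_def y_def)
qed

section \<open>The partial derivatives of the potential\<close>

lemma circle_potential_eq_exp:
  assumes "D > 0" "d > 0"
  shows "circle_potential M D d = - M * exp (- ln (agm D d))"
  using agm_pos[OF assms] by (simp add: circle_potential_def exp_minus field_simps)

lemma DERIV_circle_potential_exp_path:
  assumes "D > 0" "d > 0"
  shows "((\<lambda>t. circle_potential M (D * exp (p * t)) (d * exp (q * t))) has_real_derivative
           - (p + (q - p) * chi D d) * circle_potential M D d) (at 0)"
proof -
  have "((\<lambda>t. - M * exp (- ln (agm (D * exp (p * t)) (d * exp (q * t))))) has_real_derivative
      - M * (exp (- ln (agm D d)) * - (p + (q - p) * chi D d))) (at 0)"
    by (rule derivative_eq_intros DERIV_ln_agm_exp_path[OF assms] refl)+ simp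
  then show ?thesis
    using assms by (simp add: circle_potential_eq_exp algebra_simps)
qed

text \<open>The substitution \<open>s = a e\<^sup>t\<close> turns a derivative in the logarithmic coordinate \<open>t\<close> into an
  ordinary one.\<close>

lemma DERIV_of_exp_substitution:
  fixes f :: "real \<Rightarrow> real"
  assumes "a > 0" and f: "((\<lambda>t. f (a * exp t)) has_real_derivative c) (at 0)"
  shows "(f has_real_derivative c / a) (at a)"
proof -
  have "((\<lambda>s. ln (s / a)) has_real_derivative 1 / a) (at a)"
    using assms(1) by (auto intro!: derivative_eq_intros)
  moreover have "((\<lambda>t. f (a * exp t)) has_real_derivative c) (at (ln (a / a)))"
    using f assms(1) by simp
  ultimately have "((\<lambda>s. f (a * exp (ln (s / a)))) has_real_derivative c * (1 / a)) (at a)"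
    by (rule DERIV_chain2[rotated])
  then have "((\<lambda>s. f (a * exp (ln (s / a)))) has_real_derivative c / a) (at a)"
    by simp
  then show ?thesis
    by (rule has_field_derivative_transform_within_open[where S = "{0<..}"])
       (use assms(1) in auto)
qed

theorem proposition5:
  fixes M D d :: real
  assumes "M > 0" and "d > 0" and "D \<ge> d"
  shows "summable (\<lambda>n. chi_term D d (Suc n))
    \<and> ((\<lambda>x. circle_potential M x d) has_real_derivative
          (chi D d - 1) / D * circle_potential M D d) (at D)
    \<and> ((\<lambda>y. circle_potential M D y) has_real_derivative
          - (chi D d / d) * circle_potential M D d) (at d)"
proof (intro conjI)
  have pos: "D > 0" "d > 0"
    using assms by auto
  show "summable (\<lambda>n. chi_term D d (Suc n))"
    using pos by (rule summable_chi_term)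
  have "((\<lambda>t. circle_potential M (D * exp t) d) has_real_derivative
      (chi D d - 1) * circle_potential M D d) (at 0)"
    using DERIV_circle_potential_exp_path[OF pos, of M 1 0] by simp
  from DERIV_of_exp_substitution[OF pos(1) this]
  show "((\<lambda>x. circle_potential M x d) has_real_derivative
      (chi D d - 1) / D * circle_potential M D d) (at D)"
    by simp
  have "((\<lambda>t. circle_potential M D (d * exp t)) has_real_derivative
      - chi D d * circle_potential M D d) (at 0)"
    using DERIV_circle_potential_exp_path[OF pos, of M 0 1] by simp
  from DERIV_of_exp_substitution[OF pos(2) this]
  show "((\<lambda>y. circle_potential M D y) has_real_derivative
      - (chi D d / d) * circle_potential M D d) (at d)"
    by simp
qed

end
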